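(* Let $R\ge1$ be an integer and $G=(V,E)$ a two-dimensional (square-lattice) grid graph with periodic boundary conditions of dimensions $(2R+1)k\times(2R+1)k$, $k\ge1$ an integer; let $n=(2R+1)^2k^2$ be the number of vertices of $G$. Then every state $|\psi\rangle$ prepared by a $\mathbf Z_2$-symmetric range-$R$ quantum circuit satisfies, for all choices of signs $(\sigma_e)_{e\in E}\in\{-1,1\}^E$, $$\langle\psi|\sum_{e=\{e_0,e_1\}\in E}\left(1+\sigma_eZ_{e_0}Z_{e_1}\right)|\psi\rangle\ \ge\ \frac{2n}{2R+1}.$$ In particular, for the MaxCut Hamiltonian $H_{\mathrm{MaxCut}}=\sum_{\{e_0,e_1\}\in E}\frac{1-Z_{e_0}Z_{e_1}}{2}$ of $G$, $$\langle\psi|H_{\mathrm{MaxCut}}|\psi\rangle\le2n-\frac{n}{2R+1}.$$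
   Context: Qubits are labelled by the vertices of $G$. A circuit (unitary) $U$ has range $R$ with respect to $G$ if for every vertex $v$ and every single-qubit observable $\mathcal O_v$ supported on $v$, $U^\dagger\mathcal O_vU$ is supported on the set $B_G(v,R)$ of vertices at distance at most $R$ from $v$. A state $|\phi\rangle$ on $n$ qubits is $\mathbf Z_2$-symmetric if $X^{\otimes n}|\phi\rangle=|\phi\rangle$; a unitary $U$ is $\mathbf Z_2$-symmetric if $X^{\otimes n}UX^{\otimes n}=U$. A state is prepared by a $\mathbf Z_2$-symmetric range-$R$ circuit if it equals $U|\phi\rangle$ with $U$ a $\mathbf Z_2$-symmetric range-$R$ circuit and $|\phi\rangle$ a $\mathbf Z_2$-symmetric product state. *)

theory Defs
  imports "HOL-Analysis.Analysis" "HOL-Library.Extended_Nat"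
begin

section \<open>Graphs\<close>

text \<open>A graph has all elements of a finite type as its vertices and is given by its set of edges,
  each edge being the set of its two endpoints.\<close>

definition adjacency :: "'v set set \<Rightarrow> ('v \<times> 'v) set" where
  "adjacency E = {(u, v). {u, v} \<in> E}"

text \<open>The length of a shortest walk; the infimum of the empty set is \<open>\<infinity>\<close>.\<close>

definition graph_dist :: "'v set set \<Rightarrow> 'v \<Rightarrow> 'v \<Rightarrow> enat" where
  "graph_dist E u v = (INF m\<in>{m. (u, v) \<in> adjacency E ^^ m}. enat m)"

definition graph_ball :: "'v set set \<Rightarrow> 'v \<Rightarrow> nat \<Rightarrow> 'v set" where
  "graph_ball E v R = {w. graph_dist E v w \<le> enat R}"

text \<open>The \<open>a \<times> b\<close> square-lattice grid with periodic boundary conditions, up to a labelling \<open>f\<close>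
  of the vertices by coordinates. It is a simple 4-regular graph when \<open>a, b \<ge> 3\<close>; smaller side
  lengths would produce loops or merge parallel edges.\<close>

definition torus_grid :: "nat \<Rightarrow> nat \<Rightarrow> 'v set set \<Rightarrow> bool" where
  "torus_grid a b E \<longleftrightarrow>
     (\<exists>f :: 'v \<Rightarrow> nat \<times> nat. bij_betw f UNIV ({..<a} \<times> {..<b}) \<and>
        E = {{u, v} | u v. f v = ((fst (f u) + 1) mod a, snd (f u)) \<or>
                           f v = (fst (f u), (snd (f u) + 1) mod b)})"


section \<open>Qubits labelled by the vertices\<close>

text \<open>A configuration \<open>x :: 'v \<Rightarrow> bool\<close> labels the computational basis vector in which qubit \<open>v\<close> is
  in the state 1 if \<open>x v\<close> holds and in the state 0 otherwise.\<close>

type_synonym 'v state = "complex ^ ('v \<Rightarrow> bool)"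
type_synonym 'v operator = "complex ^ ('v \<Rightarrow> bool) ^ ('v \<Rightarrow> bool)"

definition dagger :: "complex ^ 'a ^ 'b \<Rightarrow> complex ^ 'b ^ 'a" where
  "dagger A = (\<chi> i j. cnj (A $ j $ i))"

definition hermitian :: "complex ^ 'a ^ 'a \<Rightarrow> bool" where
  "hermitian A \<longleftrightarrow> dagger A = A"

definition unitary :: "complex ^ 'a ^ 'a \<Rightarrow> bool" where
  "unitary U \<longleftrightarrow> dagger U ** U = mat 1 \<and> U ** dagger U = mat 1"

text \<open>\<open>expectation \<psi> A\<close> is \<open>\<langle>\<psi>|A|\<psi>\<rangle>\<close>.\<close>

definition expectation :: "complex ^ 'a \<Rightarrow> complex ^ 'a ^ 'a \<Rightarrow> complex" where
  "expectation \<psi> A = (\<Sum>i\<in>UNIV. cnj (\<psi> $ i) * (A *v \<psi>) $ i)"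

definition tensor_state :: "('v::finite \<Rightarrow> complex ^ bool) \<Rightarrow> 'v state" where
  "tensor_state \<phi> = (\<chi> x. \<Prod>v\<in>UNIV. \<phi> v $ x v)"

definition tensor_op :: "('v::finite \<Rightarrow> complex ^ bool ^ bool) \<Rightarrow> 'v operator" where
  "tensor_op a = (\<chi> x y. \<Prod>v\<in>UNIV. a v $ x v $ y v)"

definition product_state :: "'v::finite state \<Rightarrow> bool" where
  "product_state \<psi> \<longleftrightarrow> (\<exists>\<phi>. (\<forall>v. norm (\<phi> v) = 1) \<and> \<psi> = tensor_state \<phi>)"

text \<open>The operator \<open>A\<close> has the form \<open>a \<otimes> 1\<close>, where \<open>a\<close> acts on the qubits in \<open>S\<close> and \<open>1\<close> is the
  identity on the remaining qubits; the matrix entries of \<open>a\<close> are indexed by configurations of \<open>S\<close>.\<close>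

definition supported_on :: "'v::finite set \<Rightarrow> 'v operator \<Rightarrow> bool" where
  "supported_on S A \<longleftrightarrow>
     (\<exists>a :: ('v \<Rightarrow> bool) \<Rightarrow> ('v \<Rightarrow> bool) \<Rightarrow> complex. \<forall>x y.
        A $ x $ y = (if \<forall>w. w \<notin> S \<longrightarrow> x w = y w then a (restrict x S) (restrict y S) else 0))"


section \<open>Pauli operators\<close>

definition pauli_X :: "complex ^ bool ^ bool" where
  "pauli_X = (\<chi> i j. if i \<noteq> j then 1 else 0)"

definition pauli_Z :: "complex ^ bool ^ bool" where
  "pauli_Z = (\<chi> i j. if i = j then (if i then - 1 else 1) else 0)"

definition all_X :: "'v::finite operator" where
  "all_X = tensor_op (\<lambda>_. pauli_X)"

definition Z_at :: "'v::finite \<Rightarrow> 'v operator" where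
  "Z_at v = tensor_op ((\<lambda>_. mat 1)(v := pauli_Z))"

text \<open>Pauli \<open>Z\<close> on both endpoints of the edge \<open>e\<close>; see \<open>ZZ_edge\<close> below.\<close>

definition ZZ :: "'v::finite set \<Rightarrow> 'v operator" where
  "ZZ e = tensor_op (\<lambda>v. if v \<in> e then pauli_Z else mat 1)"


section \<open>Symmetric circuits of bounded range\<close>

definition has_range :: "'v::finite set set \<Rightarrow> nat \<Rightarrow> 'v operator \<Rightarrow> bool" where
  "has_range E R U \<longleftrightarrow>
     (\<forall>v A. hermitian A \<and> supported_on {v} A \<longrightarrow>
        supported_on (graph_ball E v R) (dagger U ** A ** U))"

definition symmetric_state :: "'v::finite state \<Rightarrow> bool" where
  "symmetric_state \<psi> \<longleftrightarrow> all_X *v \<psi> = \<psi>"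

definition symmetric_op :: "'v::finite operator \<Rightarrow> bool" where
  "symmetric_op U \<longleftrightarrow> all_X ** U ** all_X = U"

definition symmetrically_prepared :: "'v::finite set set \<Rightarrow> nat \<Rightarrow> 'v state \<Rightarrow> bool" where
  "symmetrically_prepared E R \<psi> \<longleftrightarrow>
     (\<exists>U \<phi>. unitary U \<and> has_range E R U \<and> symmetric_op U \<and>
            product_state \<phi> \<and> symmetric_state \<phi> \<and> \<psi> = U *v \<phi>)"

definition maxcut_hamiltonian :: "'v::finite set set \<Rightarrow> 'v operator" where
  "maxcut_hamiltonian E = (\<Sum>e\<in>E. (1 / 2) *\<^sub>R (mat 1 - ZZ e))"


section \<open>Relation to single-site operators\<close>

lemma tensor_op_mult: "tensor_op a ** tensor_op b = tensor_op (\<lambda>v. a v ** b v)"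
proof -
  have "(\<Sum>z\<in>UNIV. (\<Prod>v\<in>UNIV. a v $ x v $ z v) * (\<Prod>v\<in>UNIV. b v $ z v $ y v)) =
        (\<Prod>v\<in>UNIV. \<Sum>s\<in>UNIV. a v $ x v $ s * b v $ s $ y v)" for x y :: "'a \<Rightarrow> bool"
    using prod_sum_PiE[of UNIV "\<lambda>_. UNIV" "\<lambda>v s. a v $ x v $ s * b v $ s $ y v"]
    by (simp add: prod.distrib PiE_UNIV_domain)
  then show ?thesis
    by (simp add: tensor_op_def matrix_matrix_mult_def vec_eq_iff)
qed

lemma ZZ_edge:
  assumes "u \<noteq> v"
  shows "ZZ {u, v} = Z_at u ** Z_at v"
  unfolding ZZ_def Z_at_def tensor_op_mult
  by (rule arg_cong[of _ _ tensor_op]) (use assms in \<open>auto simp: fun_eq_iff\<close>)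

end

theory Submission
  imports Defs
begin

text \<open>Write \<open>N = 2 R + 1\<close>. Join every vertex \<open>u\<close> to \<open>u + d\<close>, for \<open>d \<in> {-R..R}\<^sup>2\<close>, by a path with one corner.
  For a classical configuration \<open>s\<close>, the sum of \<open>1 + \<sigma>\<^sub>e s s\<close> along this path is at least
  \<open>1 - \<tau> s\<^sub>u s\<^bsub>u+d\<^esub>\<close>, where \<open>\<tau>\<close> is a sign that depends only on \<open>\<sigma>\<close>. Every edge is used by \<open>N R (R + 1)\<close>
  of the paths, so the energy \<open>H\<close> satisfies
  \<open>N R (R + 1) H \<ge> N\<^sup>2 n - \<Sum>\<^sub>u \<Sum>\<^sub>d \<tau> \<langle>Z\<^sub>u Z\<^bsub>u+d\<^esub>\<rangle>\<close>.

  In a product basis that contains the initial state, the vector \<open>U\<^sup>\<dagger> Z\<^sub>v U \<phi>\<close> only has components whose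
  excited qubits lie in the ball around \<open>v\<close>, and by symmetry none without excited qubits. A basis vector
  with excited qubit \<open>t\<close> therefore occurs only for the \<open>v\<close> whose ball contains \<open>t\<close>, of which there
  are at most \<open>D = 2 R (R + 1) + 1\<close>, and by Cauchy-Schwarz the double sum of correlations is at most \<open>D n\<close>.
  Since \<open>N\<^sup>2 - D = 2 R (R + 1)\<close>, it follows that \<open>H \<ge> 2 n / N\<close>. Disjointness of balls is not needed,
  which matters for \<open>k = 1\<close>, where any two balls of radius \<open>R\<close> intersect.\<close>

section \<open>Translations of the torus\<close>

text \<open>The integer plane acts by translations, and a displacement that fixes a vertex has both
  coordinates divisible by \<open>L\<close>. Displacements stay integers, so paths and distances can
  be handled without modular arithmetic.\<close>

locale torus_action =
  fixes sh :: "int \<Rightarrow> int \<Rightarrow> 'v::finite \<Rightarrow> 'v" and L :: int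
  assumes sh_0: "sh 0 0 v = v"
    and sh_sh: "sh a b (sh c d v) = sh (a + c) (b + d) v"
    and sh_free: "sh a b v = v \<Longrightarrow> L dvd a \<and> L dvd b"
begin

definition grid :: "'v set set" where
  "grid = range (\<lambda>v. {v, sh 1 0 v}) \<union> range (\<lambda>v. {v, sh 0 1 v})"

lemma sh_inverse: "sh a b (sh (- a) (- b) v) = v" "sh (- a) (- b) (sh a b v) = v"
  by (simp_all add: sh_sh sh_0)

lemma bij_sh: "bij (sh a b)"
  by (rule o_bij[where g = "sh (- a) (- b)"]) (simp_all add: fun_eq_iff sh_inverse)

lemma sum_sh: "(\<Sum>v\<in>UNIV. F (sh a b v)) = (\<Sum>v\<in>UNIV. F v)"
  using sum.reindex_bij_betw[OF bij_sh] .

lemma sh_eqD: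
  assumes "sh a b v = sh c d v"
  shows "L dvd a - c \<and> L dvd b - d"
proof -
  have "sh (a - c) (b - d) v = sh (- c) (- d) (sh a b v)"
    by (simp add: sh_sh)
  also have "\<dots> = v"
    using assms by (simp add: sh_inverse)
  finally show ?thesis
    by (rule sh_free)
qed

text \<open>Coordinates of two displacements in the box differ by at most \<open>2 * R < L\<close>,
  so a difference divisible by \<open>L\<close> is zero.\<close>

lemma inj_on_sh:
  assumes "2 * int R < L"
  shows "inj_on (\<lambda>(a, b). sh a b v) ({- int R..int R} \<times> {- int R..int R})"
proof (rule inj_onI, clarsimp)
  fix a b c d
  assume *: "- int R \<le> a" "a \<le> int R" "- int R \<le> b" "b \<le> int R"
    "- int R \<le> c" "c \<le> int R" "- int R \<le> d" "d \<le> int R" and eq: "sh a b v = sh c d v"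
  have "a - c = 0"
    by (rule ccontr) (use dvd_imp_le_int[of "a - c" L] sh_eqD[OF eq] * assms in linarith)
  moreover have "b - d = 0"
    by (rule ccontr) (use dvd_imp_le_int[of "b - d" L] sh_eqD[OF eq] * assms in linarith)
  ultimately show "a = c \<and> b = d"
    by simp
qed

lemma grid_edge_proper:
  assumes "L > 1"
  shows "sh 1 0 v \<noteq> v" "sh 0 1 v \<noteq> v"
  using assms sh_free[of 1 0 v] sh_free[of 0 1 v] by auto

text \<open>For \<open>L > 2\<close> an edge determines its direction and its base vertex: a second
  base vertex in the same direction would make two steps return to the start.\<close>

lemma sum_grid:
  fixes F :: "'v set \<Rightarrow> real"
  assumes "L > 2"
  shows "sum F grid = (\<Sum>v\<in>UNIV. F {v, sh 1 0 v}) + (\<Sum>v\<in>UNIV. F {v, sh 0 1 v})"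
proof -
  have *: "\<not> L dvd 2" "\<not> L dvd 1"
    using assms zdvd_imp_le[of L 2] zdvd_imp_le[of L 1] by auto
  then have no2: "sh 2 0 v \<noteq> v" "sh 0 2 v \<noteq> v" for v
    using sh_free[of 2 0 v] sh_free[of 0 2 v] by auto
  have 1: "inj (\<lambda>v. {v, sh 1 0 v})"
    by (rule injI) (auto simp: doubleton_eq_iff sh_sh no2)
  have 2: "inj (\<lambda>v. {v, sh 0 1 v})"
    by (rule injI) (auto simp: doubleton_eq_iff sh_sh no2)
  have "{u, sh 1 0 u} \<noteq> {v, sh 0 1 v}" for u v
  proof
    assume "{u, sh 1 0 u} = {v, sh 0 1 v}"
    \<comment> \<open>The two ways of matching endpoints: either \<open>u = v\<close>, or
      \<open>u = sh 0 1 v\<close> and \<open>v = sh 1 0 u\<close>.\<close>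
    then have "sh 1 0 u = sh 0 1 u \<or> sh 1 1 v = v"
      by (auto simp: doubleton_eq_iff sh_sh)
    then show False
      using sh_eqD[of 1 0 u 0 1] sh_free[of 1 1 v] * by auto
  qed
  then have "range (\<lambda>v. {v, sh 1 0 v}) \<inter> range (\<lambda>v. {v, sh 0 1 v}) = {}"
    by auto
  then show ?thesis
    unfolding grid_def
    by (subst sum.union_disjoint) (auto simp: sum.reindex[OF 1] sum.reindex[OF 2])
qed

text \<open>Each edge is a unit step in one coordinate, so the l1-norm of the displacement grows by
  at most one per step.\<close>

lemma walk_displacement:
  assumes "(u, v) \<in> adjacency grid ^^ m"
  shows "\<exists>a b. \<bar>a\<bar> + \<bar>b\<bar> \<le> int m \<and> v = sh a b u"
  using assms
proof (induction m arbitrary: v)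
  case 0
  then show ?case
    by (auto intro!: exI[of _ 0] simp: sh_0)
next
  case (Suc m)
  then obtain w where "(u, w) \<in> adjacency grid ^^ m" and wv: "{w, v} \<in> grid"
    by (auto simp: adjacency_def)
  with Suc.IH obtain a b where ab: "\<bar>a\<bar> + \<bar>b\<bar> \<le> int m" "w = sh a b u"
    by blast
  from wv have "v = sh 1 0 w \<or> w = sh 1 0 v \<or> v = sh 0 1 w \<or> w = sh 0 1 v"
    by (auto simp: grid_def doubleton_eq_iff)
  then have "v = sh 1 0 w \<or> v = sh (- 1) 0 w \<or> v = sh 0 1 w \<or> v = sh 0 (- 1) w"
    by (auto simp: sh_sh sh_0)
  then have "v = sh (1 + a) b u \<or> v = sh (- 1 + a) b u \<or> v = sh a (1 + b) u \<or> v = sh a (- 1 + b) u"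
    by (auto simp: ab(2) sh_sh)
  moreover have "\<bar>1 + a\<bar> + \<bar>b\<bar> \<le> int (Suc m)" "\<bar>- 1 + a\<bar> + \<bar>b\<bar> \<le> int (Suc m)"
    "\<bar>a\<bar> + \<bar>1 + b\<bar> \<le> int (Suc m)" "\<bar>a\<bar> + \<bar>- 1 + b\<bar> \<le> int (Suc m)"
    using ab(1) by auto
  ultimately show ?case
    by blast
qed

end

section \<open>Balls in the torus grid\<close>

lemma graph_ball_walk:
  assumes "w \<in> graph_ball E v R"
  shows "\<exists>m\<le>R. (v, w) \<in> adjacency E ^^ m"
proof -
  let ?M = "{m. (v, w) \<in> adjacency E ^^ m}"
  have le: "Inf (enat ` ?M) \<le> enat R"
    using assms by (simp add: graph_ball_def graph_dist_def)
  \<comment> \<open>An empty set of walk lengths would have infimum \<infinity>, which exceeds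
    \<open>enat R\<close>; a nonempty one attains its infimum.\<close>
  have "enat ` ?M \<noteq> {}"
  proof
    assume "enat ` ?M = {}"
    then show False
      using le by (simp only: Inf_enat_def) simp
  qed
  then have "Inf (enat ` ?M) \<in> enat ` ?M"
    by (metis Inf_enat_def LeastI ex_in_conv)
  with le show ?thesis
    by auto
qed

lemma sum_abs_interval: "(\<Sum>a\<in>{- int R..int R}. \<bar>a\<bar>) = int R * (int R + 1)"
proof (induction R)
  case (Suc R)
  have "{- int (Suc R)..int (Suc R)} = insert (- int (Suc R)) (insert (int (Suc R)) {- int R..int R})"
    by auto
  then show ?case
    using Suc by (simp add: algebra_simps)
qed simp

text \<open>The l1-ball of radius \<open>R\<close> in the integer plane, cut into columns so that
  its size is a sum over the first coordinate.\<close>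

definition diamond :: "nat \<Rightarrow> (int \<times> int) set" where
  "diamond R = (SIGMA a:{- int R..int R}. {- (int R - \<bar>a\<bar>)..int R - \<bar>a\<bar>})"

lemma finite_diamond: "finite (diamond R)"
  by (simp add: diamond_def)

lemma card_diamond: "int (card (diamond R)) = 2 * int R * (int R + 1) + 1"
proof -
  have "int (card (diamond R)) = (\<Sum>a\<in>{- int R..int R}. 2 * int R + 1 - 2 * \<bar>a\<bar>)"
    by (simp add: diamond_def) (intro sum.cong, auto)
  also have "\<dots> = (2 * int R + 1) * (2 * int R + 1) - 2 * (int R * (int R + 1))"
    by (simp add: sum_subtractf sum_distrib_left[symmetric] sum_abs_interval)
  finally show ?thesis
    by (simp add: algebra_simps)
qed

context torus_action
begin

text \<open>If the ball around \<open>v\<close> contains \<open>t\<close>, then \<open>v\<close> is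
  reached from \<open>t\<close> by undoing a displacement in the diamond.\<close>

lemma card_balls_containing: "card {v. t \<in> graph_ball grid v R} \<le> card (diamond R)"
proof -
  have "{v. t \<in> graph_ball grid v R} \<subseteq> (\<lambda>(a, b). sh (- a) (- b) t) ` diamond R"
  proof
    fix v assume "v \<in> {v. t \<in> graph_ball grid v R}"
    then obtain m where "m \<le> R" "(v, t) \<in> adjacency grid ^^ m"
      using graph_ball_walk[of t grid v R] by auto
    then obtain a b where ab: "\<bar>a\<bar> + \<bar>b\<bar> \<le> int m" "t = sh a b v"
      using walk_displacement[of v t m] by blast
    then have "(a, b) \<in> diamond R"
      using \<open>m \<le> R\<close> by (auto simp: diamond_def)
    moreover have "v = sh (- a) (- b) t"
      by (simp add: ab(2) sh_inverse)
    ultimately show "v \<in> (\<lambda>(a, b). sh (- a) (- b) t) ` diamond R"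
      by force
  qed
  then show ?thesis
    by (rule surj_card_le[OF finite_diamond])
qed

end

section \<open>Frustration along paths\<close>

text \<open>A product of two signs is -1 only if one factor is. This subadditivity is what allows
  paths to be glued together.\<close>

lemma sign_triangle:
  fixes p q :: real
  assumes "p \<in> {-1, 1}" "q \<in> {-1, 1}"
  shows "1 - p * q \<le> (1 - p) + (1 - q)"
  using assms by auto

lemma prod_sign:
  fixes \<eta> :: "'a \<Rightarrow> real"
  assumes "\<And>i. \<eta> i \<in> {-1, 1}"
  shows "prod \<eta> I \<in> {-1, 1}"
proof (induction I rule: infinite_finite_induct)
  case (insert x F)
  then show ?case
    using assms[of x] by auto
qed auto

text \<open>The edge terms \<open>\<eta> i * f i * f (i + 1)\<close> multiply to the left-hand
  product, because each interior value of \<open>f\<close> occurs twice and squares to 1;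
  \<open>sign_triangle\<close> then appends one edge at a time.\<close>

lemma path_frustration:
  fixes \<eta> f :: "int \<Rightarrow> real"
  assumes \<eta>: "\<And>i. \<eta> i \<in> {-1, 1}" and f: "\<And>i. f i \<in> {-1, 1}" and "m \<le> M"
  shows "1 - prod \<eta> {m..<M} * f m * f M \<le> (\<Sum>i\<in>{m..<M}. 1 - \<eta> i * f i * f (i + 1))"
  using \<open>m \<le> M\<close>
proof (induction rule: int_ge_induct)
  case base
  then show ?case
    using f[of m] by auto
next
  case (step M)
  have eq: "{m..<M + 1} = insert M {m..<M}"
    using step by auto
  have sq: "f M * f M = 1"
    using f[of M] by auto
  have "1 - (prod \<eta> {m..<M} * f m * f M) * (\<eta> M * f M * f (M + 1))
      \<le> (1 - prod \<eta> {m..<M} * f m * f M) + (1 - \<eta> M * f M * f (M + 1))"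
    by (rule sign_triangle)
      (use prod_sign[of \<eta> "{m..<M}", OF \<eta>] f[of m] f[of M] f[of "M + 1"] \<eta>[of M] in auto)
  also have "(prod \<eta> {m..<M} * f m * f M) * (\<eta> M * f M * f (M + 1))
      = (prod \<eta> {m..<M} * \<eta> M) * f m * f (M + 1) * (f M * f M)"
    by (simp only: ac_simps)
  finally show ?case
    using step.IH by (simp add: eq sq mult.commute)
qed

text \<open>An edge is indexed by its smaller endpoint, so a path towards a negative
  \<open>a\<close> uses the edges from \<open>a\<close> to \<open>-1\<close>, traversed
  backwards.\<close>

definition path_idx :: "int \<Rightarrow> int set" where
  "path_idx a = {min 0 a..<max 0 a}"

lemma card_path_idx: "int (card (path_idx a)) = \<bar>a\<bar>"
  by (cases "0 \<le> a") (simp_all add: path_idx_def)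

lemma path_frustration_from_0:
  fixes \<eta> f :: "int \<Rightarrow> real"
  assumes "\<And>i. \<eta> i \<in> {-1, 1}" and "\<And>i. f i \<in> {-1, 1}"
  shows "1 - prod \<eta> (path_idx a) * (f 0 * f a) \<le> (\<Sum>i\<in>path_idx a. 1 - \<eta> i * f i * f (i + 1))"
  using path_frustration[of \<eta> f "min 0 a" "max 0 a", OF assms]
  by (cases "0 \<le> a") (simp_all add: path_idx_def min_def max_def mult_ac)

context torus_action
begin

text \<open>The path goes from \<open>v\<close> straight to \<open>sh a 0 v\<close> and from there straight to \<open>sh a b v\<close>; \<open>\<eta>\<close> and \<open>\<kappa>\<close>
  are the signs of the edges that leave a vertex in the first and second direction.\<close>

definition path_sign :: "('v \<Rightarrow> real) \<Rightarrow> ('v \<Rightarrow> real) \<Rightarrow> int \<Rightarrow> int \<Rightarrow> 'v \<Rightarrow> real" where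
  "path_sign \<eta> \<kappa> a b v =
     (\<Prod>i\<in>path_idx a. \<eta> (sh i 0 v)) * (\<Prod>i\<in>path_idx b. \<kappa> (sh a i v))"

lemma path_sign_values:
  assumes "\<And>v. \<eta> v \<in> {-1, 1}" and "\<And>v. \<kappa> v \<in> {-1, 1}"
  shows "path_sign \<eta> \<kappa> a b v \<in> {-1, 1}"
  using prod_sign[of "\<lambda>i. \<eta> (sh i 0 v)" "path_idx a"] prod_sign[of "\<lambda>i. \<kappa> (sh a i v)" "path_idx b"] assms
  by (auto simp: path_sign_def)

text \<open>The two straight pieces meet at the corner \<open>sh a 0 v\<close>, whose spin occurs in
  both and squares to 1.\<close>

lemma corner_path_frustration:
  fixes \<eta> \<kappa> s :: "'v \<Rightarrow> real"
  assumes \<eta>: "\<And>v. \<eta> v \<in> {-1, 1}" and \<kappa>: "\<And>v. \<kappa> v \<in> {-1, 1}" and s: "\<And>v. s v \<in> {-1, 1}"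
  defines "h \<equiv> \<lambda>v. 1 - \<eta> v * s v * s (sh 1 0 v)" and "g \<equiv> \<lambda>v. 1 - \<kappa> v * s v * s (sh 0 1 v)"
  shows "1 - path_sign \<eta> \<kappa> a b v * (s v * s (sh a b v))
      \<le> (\<Sum>i\<in>path_idx a. h (sh i 0 v)) + (\<Sum>i\<in>path_idx b. g (sh a i v))"
proof -
  let ?p = "\<Prod>i\<in>path_idx a. \<eta> (sh i 0 v)" and ?q = "\<Prod>i\<in>path_idx b. \<kappa> (sh a i v)"
  have 1: "1 - ?p * (s v * s (sh a 0 v)) \<le> (\<Sum>i\<in>path_idx a. h (sh i 0 v))"
    using path_frustration_from_0[of "\<lambda>i. \<eta> (sh i 0 v)" "\<lambda>i. s (sh i 0 v)" a, OF \<eta> s]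
    by (simp add: h_def sh_0 sh_sh add.commute)
  have 2: "1 - ?q * (s (sh a 0 v) * s (sh a b v)) \<le> (\<Sum>i\<in>path_idx b. g (sh a i v))"
    using path_frustration_from_0[of "\<lambda>i. \<kappa> (sh a i v)" "\<lambda>i. s (sh a i v)" b, OF \<kappa> s]
    by (simp add: g_def sh_sh add.commute)
  have sq: "s (sh a 0 v) * s (sh a 0 v) = 1"
    using s[of "sh a 0 v"] by auto
  have "?p \<in> {-1, 1}" "?q \<in> {-1, 1}"
    using prod_sign[of "\<lambda>i. \<eta> (sh i 0 v)"] prod_sign[of "\<lambda>i. \<kappa> (sh a i v)"] \<eta> \<kappa> by blast+
  then have "1 - (?p * (s v * s (sh a 0 v))) * (?q * (s (sh a 0 v) * s (sh a b v)))
      \<le> (1 - ?p * (s v * s (sh a 0 v))) + (1 - ?q * (s (sh a 0 v) * s (sh a b v)))"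
    by (intro sign_triangle) (use s[of v] s[of "sh a 0 v"] s[of "sh a b v"] in auto)
  also have "(?p * (s v * s (sh a 0 v))) * (?q * (s (sh a 0 v) * s (sh a b v)))
      = path_sign \<eta> \<kappa> a b v * (s v * s (sh a b v)) * (s (sh a 0 v) * s (sh a 0 v))"
    by (simp only: path_sign_def ac_simps)
  finally show ?thesis
    using 1 2 sq by simp
qed

text \<open>After summation over \<open>v\<close>, translation invariance leaves only the number of
  edges of a path in each direction. Over the box these numbers add up to \<open>R * (R + 1)\<close>
  along one coordinate, times \<open>2 * R + 1\<close> choices of the other.\<close>

lemma total_frustration:
  fixes \<eta> \<kappa> s :: "'v \<Rightarrow> real"
  assumes \<eta>: "\<And>v. \<eta> v \<in> {-1, 1}" and \<kappa>: "\<And>v. \<kappa> v \<in> {-1, 1}" and s: "\<And>v. s v \<in> {-1, 1}"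
  shows "(\<Sum>(a, b)\<in>{- int R..int R} \<times> {- int R..int R}. \<Sum>v\<in>UNIV.
            1 - path_sign \<eta> \<kappa> a b v * (s v * s (sh a b v)))
      \<le> (2 * real R + 1) * (real R * (real R + 1)) *
         ((\<Sum>v\<in>UNIV. 1 - \<eta> v * s v * s (sh 1 0 v)) + (\<Sum>v\<in>UNIV. 1 - \<kappa> v * s v * s (sh 0 1 v)))"
proof -
  let ?I = "{- int R..int R}"
  define h where "h = (\<lambda>v. 1 - \<eta> v * s v * s (sh 1 0 v))"
  define g where "g = (\<lambda>v. 1 - \<kappa> v * s v * s (sh 0 1 v))"
  have abs_sum: "(\<Sum>a\<in>?I. real (card (path_idx a))) = real R * (real R + 1)"
  proof -
    have "(\<Sum>a\<in>?I. real (card (path_idx a))) = (\<Sum>a\<in>?I. real_of_int \<bar>a\<bar>)"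
      by (intro sum.cong refl) (metis card_path_idx of_int_of_nat_eq)
    also have "\<dots> = real_of_int (\<Sum>a\<in>?I. \<bar>a\<bar>)"
      by simp
    finally show ?thesis
      by (simp add: sum_abs_interval)
  qed
  have "(\<Sum>v\<in>UNIV. 1 - path_sign \<eta> \<kappa> a b v * (s v * s (sh a b v)))
      \<le> real (card (path_idx a)) * sum h UNIV + real (card (path_idx b)) * sum g UNIV" for a b
  proof -
    have "(\<Sum>v\<in>UNIV. 1 - path_sign \<eta> \<kappa> a b v * (s v * s (sh a b v)))
        \<le> (\<Sum>v\<in>UNIV. (\<Sum>i\<in>path_idx a. h (sh i 0 v)) + (\<Sum>i\<in>path_idx b. g (sh a i v)))"
      unfolding h_def g_def by (intro sum_mono corner_path_frustration[OF assms])
    also have "\<dots> = (\<Sum>i\<in>path_idx a. \<Sum>v\<in>UNIV. h (sh i 0 v)) + (\<Sum>i\<in>path_idx b. \<Sum>v\<in>UNIV. g (sh a i v))"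
      by (simp add: sum.distrib) (simp only: sum.swap[of _ UNIV])
    finally show ?thesis
      by (simp add: sum_sh)
  qed
  then have "(\<Sum>(a, b)\<in>?I \<times> ?I. \<Sum>v\<in>UNIV. 1 - path_sign \<eta> \<kappa> a b v * (s v * s (sh a b v)))
      \<le> (\<Sum>(a, b)\<in>?I \<times> ?I. real (card (path_idx a)) * sum h UNIV + real (card (path_idx b)) * sum g UNIV)"
    by (intro sum_mono) auto
  also have "\<dots> = (\<Sum>a\<in>?I. \<Sum>b\<in>?I. real (card (path_idx a)) * sum h UNIV + real (card (path_idx b)) * sum g UNIV)"
    by (simp add: sum.cartesian_product)
  also have "\<dots> = (2 * real R + 1) * (real R * (real R + 1)) * (sum h UNIV + sum g UNIV)"
    by (simp add: sum.distrib sum_distrib_right[symmetric] sum_distrib_left[symmetric] abs_sum) (simp add: algebra_simps)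
  finally show ?thesis
    by (simp add: h_def g_def)
qed

end

section \<open>Tensor products and Pauli operators\<close>

lemma dagger_nth: "dagger A $ i $ j = cnj (A $ j $ i)"
  by (simp add: dagger_def)

lemma dagger_mult: "dagger (A ** B) = dagger B ** dagger A"
  by (simp add: vec_eq_iff dagger_def matrix_matrix_mult_def mult.commute)

lemma dagger_dagger: "dagger (dagger A) = A"
  by (simp add: vec_eq_iff dagger_def)

lemma dagger_tensor_op: "dagger (tensor_op a) = tensor_op (\<lambda>v. dagger (a v))"
  by (simp add: vec_eq_iff dagger_def tensor_op_def cnj_prod)

lemma tensor_op_one: "tensor_op (\<lambda>_. mat 1) = mat 1"
  by (auto simp: vec_eq_iff tensor_op_def mat_def fun_eq_iff intro!: prod.neutral prod_zero)

lemma tensor_op_diagonal: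
  assumes "\<And>v i j. i \<noteq> j \<Longrightarrow> a v $ i $ j = 0"
  shows "tensor_op a $ x $ y = (if x = y then \<Prod>v\<in>UNIV. a v $ x v $ x v else 0)"
proof (cases "x = y")
  case False
  then obtain v where "x v \<noteq> y v"
    by auto
  then have "(\<Prod>v\<in>UNIV. a v $ x v $ y v) = 0"
    using assms[of "x v" "y v" v] by (intro prod_zero bexI[of _ v]) simp_all
  with False show ?thesis
    by (simp add: tensor_op_def)
qed (simp add: tensor_op_def)

lemma isometry_inner:
  fixes V :: "complex ^ 'a ^ 'a"
  assumes "dagger V ** V = mat 1"
  shows "(\<Sum>i\<in>UNIV. cnj ((V *v f) $ i) * (V *v g) $ i) = (\<Sum>i\<in>UNIV. cnj (f $ i) * g $ i)"
proof -
  have adj: "(\<Sum>i\<in>UNIV. cnj ((A *v f) $ i) * h $ i) = (\<Sum>i\<in>UNIV. cnj (f $ i) * (dagger A *v h) $ i)"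
    for A :: "complex ^ 'a ^ 'a" and h
  proof -
    have "(\<Sum>i\<in>UNIV. cnj ((A *v f) $ i) * h $ i) = (\<Sum>i\<in>UNIV. \<Sum>j\<in>UNIV. cnj (A $ i $ j) * cnj (f $ j) * h $ i)"
      by (simp add: matrix_vector_mult_def cnj_sum sum_distrib_right)
    also have "\<dots> = (\<Sum>j\<in>UNIV. \<Sum>i\<in>UNIV. cnj (A $ i $ j) * cnj (f $ j) * h $ i)"
      by (rule sum.swap)
    finally show ?thesis
      by (simp add: matrix_vector_mult_def dagger_def sum_distrib_left mult_ac)
  qed
  show ?thesis
    by (simp add: adj matrix_vector_mul_assoc assms)
qed

section \<open>Pauli operators in the computational basis\<close>

definition spin :: "bool \<Rightarrow> real" where
  "spin b = (if b then - 1 else 1)"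

lemma spin_values: "spin b \<in> {- 1, 1}"
  by (simp add: spin_def)

lemma spin_not: "spin (\<not> b) = - spin b"
  by (simp add: spin_def)

lemma ZZ_nth: "ZZ e $ x $ y = (if x = y then of_real (\<Prod>w\<in>e. spin (x w)) else 0)"
proof -
  have "(\<Prod>w\<in>UNIV. (if w \<in> e then pauli_Z else mat 1) $ x w $ x w)
      = (\<Prod>w\<in>UNIV. if w \<in> e then complex_of_real (spin (x w)) else 1)"
    by (intro prod.cong refl) (auto simp: pauli_Z_def mat_def spin_def)
  also have "\<dots> = of_real (\<Prod>w\<in>e. spin (x w))"
    by (simp add: prod.If_cases)
  finally show ?thesis
    unfolding ZZ_def by (subst tensor_op_diagonal) (auto simp: pauli_Z_def mat_def)
qed

lemma Z_at_nth: "Z_at v $ x $ y = (if x = y then of_real (spin (x v)) else 0)"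
proof -
  have "(\<Prod>w\<in>UNIV. ((\<lambda>_. mat 1)(v := pauli_Z)) w $ x w $ x w)
      = (\<Prod>w\<in>UNIV. if w = v then complex_of_real (spin (x v)) else 1)"
    by (intro prod.cong refl) (auto simp: pauli_Z_def mat_def spin_def)
  also have "\<dots> = of_real (spin (x v))"
    by simp
  finally show ?thesis
    unfolding Z_at_def by (subst tensor_op_diagonal) (auto simp: pauli_Z_def mat_def)
qed

lemma diagonal_mult_vec:
  fixes A :: "complex ^ 'a ^ 'a"
  assumes "\<And>x y. A $ x $ y = (if x = y then d x else 0)"
  shows "(A *v f) $ x = d x * f $ x"
  by (simp add: matrix_vector_mult_def assms if_distrib[of "\<lambda>c. c * _"] cong: if_cong)

lemma Z_at_mult_vec: "(Z_at v *v \<psi>) $ x = of_real (spin (x v)) * \<psi> $ x"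
  by (rule diagonal_mult_vec) (rule Z_at_nth)

lemma hermitian_Z_at: "hermitian (Z_at v)"
  by (auto simp: hermitian_def vec_eq_iff dagger_nth Z_at_nth)

lemma supported_on_Z_at: "supported_on {v} (Z_at v)"
  unfolding supported_on_def
proof (intro exI allI)
  fix x y :: "'a \<Rightarrow> bool"
  show "Z_at v $ x $ y = (if \<forall>w. w \<notin> {v} \<longrightarrow> x w = y w
      then (\<lambda>p q. if p v = q v then of_real (spin (p v)) else 0) (restrict x {v}) (restrict y {v}) else 0)"
    by (auto simp: Z_at_nth fun_eq_iff)
qed

lemma all_X_mult_vec: "(all_X *v \<psi>) $ x = \<psi> $ (\<lambda>v. \<not> x v)"
proof -
  have "all_X $ x $ y = (if y = (\<lambda>v. \<not> x v) then 1 else 0)" for y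
  proof (cases "y = (\<lambda>v. \<not> x v)")
    case False
    then obtain v where "x v = y v"
      by auto
    with False show ?thesis
      by (auto simp: all_X_def tensor_op_def pauli_X_def intro!: prod_zero)
  qed (simp add: all_X_def tensor_op_def pauli_X_def)
  then show ?thesis
    by (simp add: matrix_vector_mult_def if_distrib[of "\<lambda>c. c * _"] cong: if_cong)
qed

text \<open>Flipping all bits preserves the amplitudes and negates the spin, so the sum equals its
  own negative.\<close>

lemma symmetric_mean_zero:
  assumes "symmetric_state \<psi>"
  shows "(\<Sum>x\<in>UNIV. cnj (\<psi> $ x) * (of_real (spin (x v)) * \<psi> $ x)) = 0" (is "sum ?F UNIV = 0")
proof -
  have flip: "\<psi> $ (\<lambda>v. \<not> x v) = \<psi> $ x" for x
    using assms all_X_mult_vec[of \<psi> x] by (simp add: symmetric_state_def)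
  have "bij (\<lambda>(x :: 'a \<Rightarrow> bool) v. \<not> x v)"
    by (rule o_bij[where g = "\<lambda>x v. \<not> x v"]) (simp_all add: fun_eq_iff)
  then have "sum ?F UNIV = (\<Sum>x\<in>UNIV. ?F (\<lambda>v. \<not> x v))"
    by (rule sum.reindex_bij_betw[symmetric])
  also have "\<dots> = - sum ?F UNIV"
    by (simp add: flip spin_not sum_negf)
  finally show ?thesis
    by simp
qed

text \<open>The first column is \<open>\<phi>\<close>, the second a unit vector orthogonal to it.\<close>

definition rotation :: "complex ^ bool \<Rightarrow> complex ^ bool ^ bool" where
  "rotation \<phi> = (\<chi> i j. if j then (if i then cnj (\<phi> $ False) else - cnj (\<phi> $ True)) else \<phi> $ i)"

lemma unit_qubit:
  fixes \<phi> :: "complex ^ bool"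
  assumes "norm \<phi> = 1"
  shows "\<phi> $ False * cnj (\<phi> $ False) + \<phi> $ True * cnj (\<phi> $ True) = 1"
proof -
  have "(norm (\<phi> $ False))\<^sup>2 + (norm (\<phi> $ True))\<^sup>2 = 1"
    using assms by (simp add: norm_vec_def L2_set_def UNIV_bool)
  then show ?thesis
    by (simp only: complex_norm_square[symmetric] of_real_add[symmetric] of_real_eq_1_iff)
qed

lemma rotation_unitary:
  assumes "norm \<phi> = 1"
  shows "rotation \<phi> ** dagger (rotation \<phi>) = mat 1"
proof -
  have "(rotation \<phi> ** dagger (rotation \<phi>)) $ i $ j = mat 1 $ i $ j" for i j
    using unit_qubit[OF assms]
    by (cases i; cases j) (auto simp: matrix_matrix_mult_def dagger_nth rotation_def mat_def UNIV_bool algebra_simps)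
  then show ?thesis
    by (simp add: vec_eq_iff)
qed

section \<open>Local operators in a rotated product basis\<close>

lemma bij_flip_at: "bij (\<lambda>x :: 'a \<Rightarrow> bool. x(t := \<not> x t))"
  by (rule o_bij[where g = "\<lambda>x. x(t := \<not> x t)"]) (simp_all add: fun_eq_iff)

text \<open>Since \<open>A\<close> acts as the identity on qubit \<open>t\<close>, the vector it
  produces still has the factor \<open>\<phi> t\<close> there, while \<open>x t\<close> selects the
  second column of the rotation, which is orthogonal to \<open>\<phi> t\<close>.\<close>

lemma rotated_local_vanishes:
  fixes A :: "'v::finite operator"
  assumes A: "supported_on S A" and t: "t \<notin> S" and x: "x t"
  shows "(dagger (tensor_op (\<lambda>v. rotation (\<phi> v))) *v (A *v tensor_state \<phi>)) $ x = 0"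
proof -
  let ?fl = "\<lambda>x :: 'v \<Rightarrow> bool. x(t := \<not> x t)"
  obtain a where a: "A $ y $ z =
      (if \<forall>w. w \<notin> S \<longrightarrow> y w = z w then a (restrict y S) (restrict z S) else 0)" for y z
    using A unfolding supported_on_def by blast
  define G where "G y = (\<Sum>z\<in>UNIV. A $ y $ z * (\<Prod>v\<in>UNIV - {t}. \<phi> v $ z v))" for y
  define K where "K y = (\<Prod>v\<in>UNIV - {t}. cnj (rotation (\<phi> v) $ y v $ x v))" for y
  have A_eq: "A $ y $ z = 0 \<or> z t = y t" for y z
    using t by (auto simp: a)
  have state: "(A *v tensor_state \<phi>) $ y = \<phi> t $ y t * G y" for y
  proof -
    have "A $ y $ z * tensor_state \<phi> $ z = \<phi> t $ y t * (A $ y $ z * (\<Prod>v\<in>UNIV - {t}. \<phi> v $ z v))" (is "?l z = ?r z") for z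
      using A_eq[of y z] by (auto simp: tensor_state_def prod.remove[of UNIV t])
    then show ?thesis
      unfolding matrix_vector_mult_def G_def sum_distrib_left vec_lambda_beta
      by (intro sum.cong refl)
  qed
  have A_flip: "A $ ?fl y $ ?fl z = A $ y $ z" for y z
  proof -
    have "restrict (?fl y) S = restrict y S" for y
      using t by (auto simp: fun_eq_iff)
    moreover have "(\<forall>w. w \<notin> S \<longrightarrow> ?fl y w = ?fl z w) \<longleftrightarrow> (\<forall>w. w \<notin> S \<longrightarrow> y w = z w)"
      by auto
    ultimately show ?thesis
      by (simp only: a)
  qed
  have G_flip: "G (?fl y) = G y" for y
  proof -
    have "G (?fl y) = (\<Sum>z\<in>UNIV. A $ ?fl y $ ?fl z * (\<Prod>v\<in>UNIV - {t}. \<phi> v $ ?fl z v))"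
      unfolding G_def by (rule sum.reindex_bij_betw[OF bij_flip_at, symmetric])
    also have "\<dots> = G y"
      unfolding G_def A_flip by (intro sum.cong refl arg_cong2[of _ _ _ _ "(*)"] prod.cong) auto
    finally show ?thesis .
  qed
  have K_flip: "K (?fl y) = K y" for y
    unfolding K_def by (intro prod.cong refl) auto
  \<comment> \<open>The orthogonality at \<open>t\<close> appears as antisymmetry under a flip of
    \<open>y t\<close>: the factor at \<open>t\<close> changes sign, and \<open>K\<close> and
    \<open>G\<close> do not depend on \<open>y t\<close>.\<close>
  define F where "F y = cnj (rotation (\<phi> t) $ y t $ True) * \<phi> t $ y t * (K y * G y)" for y
  have F_flip: "F (?fl y) = - F y" for y
    using G_flip[of y] K_flip[of y] by (cases "y t") (simp_all add: F_def rotation_def)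
  have "sum F UNIV = (\<Sum>y\<in>UNIV. F (?fl y))"
    by (rule sum.reindex_bij_betw[OF bij_flip_at, symmetric])
  also have "\<dots> = - sum F UNIV"
    by (simp add: F_flip sum_negf)
  finally have "sum F UNIV = 0"
    by simp
  moreover have "(dagger (tensor_op (\<lambda>v. rotation (\<phi> v))) *v (A *v tensor_state \<phi>)) $ x = sum F UNIV"
    unfolding matrix_vector_mult_def[of "dagger _"]
    by (simp add: dagger_nth tensor_op_def state F_def K_def prod.remove[of UNIV t] cnj_prod x mult_ac)
  ultimately show ?thesis
    by simp
qed

section \<open>Correlations\<close>

lemma tensor_state_norm:
  assumes p: "\<And>v. norm (p v) = 1"
  shows "(\<Sum>x\<in>UNIV. cnj (tensor_state p $ x) * tensor_state p $ x) = 1"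
proof -
  have "(\<Sum>x\<in>UNIV. cnj (tensor_state p $ x) * tensor_state p $ x) = (\<Sum>x\<in>UNIV. \<Prod>v\<in>UNIV. p v $ x v * cnj (p v $ x v))"
    by (simp add: tensor_state_def prod.distrib mult.commute)
  also have "\<dots> = (\<Prod>v\<in>UNIV. \<Sum>b\<in>UNIV. p v $ b * cnj (p v $ b))"
    using prod_sum_PiE[of UNIV "\<lambda>_. UNIV" "\<lambda>v b. p v $ b * cnj (p v $ b)"]
    by (simp add: PiE_UNIV_domain)
  finally show ?thesis
    by (simp add: UNIV_bool unit_qubit p)
qed

text \<open>Inserting \<open>all_X\<close> in front of the invariant input turns
  \<open>all_X ** U\<close> into the conjugate \<open>all_X ** U ** all_X\<close>, which is
  \<open>U\<close>.\<close>

lemma symmetric_circuit_output: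
  assumes "symmetric_op U" and "symmetric_state \<phi>"
  shows "symmetric_state (U *v \<phi>)"
  using assms by (metis symmetric_op_def symmetric_state_def matrix_vector_mul_assoc)

text \<open>\<open>\<beta> v\<close> is \<open>Z_at v *v \<psi>\<close>, pulled back through the circuit and through the product unitary that
  takes the all-zero basis state to the initial product state. Its entry at \<open>x\<close> vanishes unless
  \<open>{t. x t}\<close> lies in the ball around \<open>v\<close>, by the light cone, and its entry at the all-zero
  configuration is the mean of \<open>Z_at v\<close> in \<open>\<psi>\<close>, which is zero by symmetry.\<close>

lemma pulled_back_correlations:
  fixes \<psi> :: "'v::finite state"
  assumes "symmetrically_prepared E R \<psi>"
  obtains \<beta> :: "'v \<Rightarrow> ('v \<Rightarrow> bool) \<Rightarrow> complex" where
    "\<And>u v. (\<Sum>x\<in>UNIV. cnj (\<beta> u x) * \<beta> v x)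
        = of_real (\<Sum>x\<in>UNIV. (norm (\<psi> $ x))\<^sup>2 * (spin (x u) * spin (x v)))"
    "\<And>x. \<exists>t. \<forall>v. \<beta> v x \<noteq> 0 \<longrightarrow> t \<in> graph_ball E v R"
    "(\<Sum>x\<in>UNIV. (norm (\<psi> $ x))\<^sup>2) = 1"
proof -
  obtain U p where U: "unitary U" "has_range E R U" "symmetric_op U"
    and p: "\<And>v. norm (p v) = 1" "symmetric_state (tensor_state p)"
    and \<psi>: "\<psi> = U *v tensor_state p"
    using assms by (auto simp: symmetrically_prepared_def product_state_def)
  define W where "W = tensor_op (\<lambda>v. rotation (p v))"
  define \<beta> where "\<beta> v x = ((dagger W ** dagger U) *v (Z_at v *v \<psi>)) $ x" for v x
  have W: "W ** dagger W = mat 1"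
    by (simp add: W_def dagger_tensor_op tensor_op_mult rotation_unitary p tensor_op_one)
  have "dagger (dagger W ** dagger U) ** (dagger W ** dagger U) = U ** (W ** dagger W) ** dagger U"
    by (simp add: dagger_mult dagger_dagger matrix_mul_assoc)
  then have iso: "dagger (dagger W ** dagger U) ** (dagger W ** dagger U) = mat 1"
    using U(1) by (simp add: W unitary_def)
  have "(\<Sum>x\<in>UNIV. cnj (\<beta> u x) * \<beta> v x)
      = of_real (\<Sum>x\<in>UNIV. (norm (\<psi> $ x))\<^sup>2 * (spin (x u) * spin (x v)))" for u v
    unfolding \<beta>_def isometry_inner[OF iso] of_real_sum
    by (intro sum.cong refl) (simp add: Z_at_mult_vec complex_norm_square mult_ac del: of_real_power)
  moreover have "\<exists>t. \<forall>v. \<beta> v x \<noteq> 0 \<longrightarrow> t \<in> graph_ball E v R" for x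
  proof (cases "\<exists>t. x t")
    case True
    \<comment> \<open>Any excited qubit of \<open>x\<close> serves as the witness, for all
      \<open>v\<close> at once.\<close>
    then obtain t where t: "x t" ..
    have "\<beta> v x = 0" if "t \<notin> graph_ball E v R" for v
    proof -
      have "supported_on (graph_ball E v R) (dagger U ** Z_at v ** U)"
        using U(2) hermitian_Z_at supported_on_Z_at unfolding has_range_def by blast
      from rotated_local_vanishes[of _ _ t x p, OF this that t] show ?thesis
        by (simp add: \<beta>_def W_def \<psi> matrix_vector_mul_assoc matrix_mul_assoc)
    qed
    then show ?thesis
      by blast
  next
    case False
    then have x: "x = (\<lambda>_. False)"
      by auto
    \<comment> \<open>The all-zero column of \<open>W\<close> is the initial product state, so this
      row of the pull-back is the bra of \<open>\<psi>\<close>.\<close>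
    have "(dagger W ** dagger U) $ x $ y = cnj (\<psi> $ y)" for y
    proof -
      have "W $ z $ x = tensor_state p $ z" for z
        by (simp add: W_def tensor_op_def tensor_state_def rotation_def x)
      then show ?thesis
        by (simp add: \<psi> matrix_matrix_mult_def matrix_vector_mult_def dagger_nth cnj_sum mult.commute)
    qed
    then have "\<beta> v x = (\<Sum>y\<in>UNIV. cnj (\<psi> $ y) * (of_real (spin (y v)) * \<psi> $ y))" for v
      by (simp add: \<beta>_def matrix_vector_mult_def[of "dagger W ** dagger U"] Z_at_mult_vec)
    also have "\<dots> v = 0" for v
      unfolding \<psi> by (intro symmetric_mean_zero symmetric_circuit_output U p)
    finally show ?thesis
      by simp
  qed
  moreover have "(\<Sum>x\<in>UNIV. (norm (\<psi> $ x))\<^sup>2) = 1"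
  proof -
    have "complex_of_real (\<Sum>x\<in>UNIV. (norm (\<psi> $ x))\<^sup>2) = (\<Sum>x\<in>UNIV. cnj (\<psi> $ x) * \<psi> $ x)"
      by (simp only: of_real_sum complex_norm_square mult.commute)
    also have "\<dots> = 1"
      using U(1) p(1) unfolding \<psi>
      by (subst isometry_inner) (auto simp: unitary_def tensor_state_norm)
    finally show ?thesis
      by (simp only: of_real_eq_1_iff)
  qed
  ultimately show thesis
    by (rule that)
qed

section \<open>Diagonal observables as classical averages\<close>

lemma expectation_diagonal:
  fixes A :: "complex ^ 'a ^ 'a"
  assumes "\<And>x y. A $ x $ y = (if x = y then of_real (d x) else 0)"
  shows "Re (expectation \<psi> A) = (\<Sum>x\<in>UNIV. (norm (\<psi> $ x))\<^sup>2 * d x)"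
proof -
  have "expectation \<psi> A = of_real (\<Sum>x\<in>UNIV. (norm (\<psi> $ x))\<^sup>2 * d x)"
    unfolding expectation_def diagonal_mult_vec[OF assms] of_real_sum
    by (intro sum.cong refl) (simp add: complex_norm_square mult_ac del: of_real_power)
  then show ?thesis
    by simp
qed

lemma expectation_energy:
  fixes \<psi> :: "'v::finite state" and \<sigma> :: "'v set \<Rightarrow> real"
  shows "Re (expectation \<psi> (\<Sum>e\<in>E. mat 1 + \<sigma> e *\<^sub>R ZZ e)) =
    (\<Sum>x\<in>UNIV. (norm (\<psi> $ x))\<^sup>2 * (\<Sum>e\<in>E. 1 + \<sigma> e * (\<Prod>w\<in>e. spin (x w))))"
  by (rule expectation_diagonal)
    (auto simp: sum_component mat_def ZZ_nth scaleR_conv_of_real[where 'a=complex])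

lemma expectation_maxcut:
  fixes \<psi> :: "'v::finite state"
  shows "Re (expectation \<psi> (maxcut_hamiltonian E)) =
    (\<Sum>x\<in>UNIV. (norm (\<psi> $ x))\<^sup>2 * (\<Sum>e\<in>E. 1 / 2 * (1 - (\<Prod>w\<in>e. spin (x w)))))"
  unfolding maxcut_hamiltonian_def
  by (rule expectation_diagonal)
    (auto simp: sum_component mat_def ZZ_nth scaleR_conv_of_real[where 'a=complex])


section \<open>The energy bound\<close>

context torus_action
begin

text \<open>For fixed \<open>x\<close>, each \<open>v\<close> meets every vertex at most once within
  its box, so the double sum is at most the square of the sum of \<open>norm (\<beta> v x)\<close>.
  At most \<open>card (diamond R)\<close> terms of that sum are nonzero; Cauchy-Schwarz and
  summation over \<open>x\<close> finish the estimate.\<close>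

lemma correlation_bound:
  fixes \<beta> :: "'v \<Rightarrow> 'x::finite \<Rightarrow> complex" and \<tau> :: "int \<Rightarrow> int \<Rightarrow> 'v \<Rightarrow> real"
  assumes L: "2 * int R < L"
    and support: "\<And>x. \<exists>t. \<forall>v. \<beta> v x \<noteq> 0 \<longrightarrow> t \<in> graph_ball grid v R"
    and unit: "\<And>v. (\<Sum>x\<in>UNIV. (norm (\<beta> v x))\<^sup>2) = 1"
    and \<tau>: "\<And>a b v. \<bar>\<tau> a b v\<bar> \<le> 1"
  shows "(\<Sum>(a, b)\<in>{- int R..int R} \<times> {- int R..int R}. \<Sum>v\<in>UNIV.
            \<tau> a b v * Re (\<Sum>x\<in>UNIV. cnj (\<beta> v x) * \<beta> (sh a b v) x))
      \<le> real (card (diamond R)) * real CARD('v)"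
proof -
  let ?B = "{- int R..int R} \<times> {- int R..int R}"
  have pair: "\<tau> a b v * Re (\<Sum>x\<in>UNIV. cnj (\<beta> v x) * \<beta> (sh a b v) x)
      \<le> (\<Sum>x\<in>UNIV. norm (\<beta> v x) * norm (\<beta> (sh a b v) x))" for a b v
  proof -
    have "\<tau> a b v * Re (\<Sum>x\<in>UNIV. cnj (\<beta> v x) * \<beta> (sh a b v) x)
        \<le> \<bar>\<tau> a b v\<bar> * \<bar>Re (\<Sum>x\<in>UNIV. cnj (\<beta> v x) * \<beta> (sh a b v) x)\<bar>"
      by (simp add: abs_mult[symmetric])
    also have "\<dots> \<le> 1 * norm (\<Sum>x\<in>UNIV. cnj (\<beta> v x) * \<beta> (sh a b v) x)"
      by (intro mult_mono \<tau> abs_Re_le_cmod) auto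
    also have "\<dots> \<le> (\<Sum>x\<in>UNIV. norm (cnj (\<beta> v x) * \<beta> (sh a b v) x))"
      by (simp add: norm_sum)
    finally show ?thesis
      by (simp add: norm_mult)
  qed
  have box: "(\<Sum>(a, b)\<in>?B. F (sh a b v)) \<le> sum F UNIV"
    if "\<And>w. 0 \<le> F w" for v and F :: "'v \<Rightarrow> real"
  proof -
    have "(\<Sum>(a, b)\<in>?B. F (sh a b v)) = sum F ((\<lambda>(a, b). sh a b v) ` ?B)"
      by (subst sum.reindex[OF inj_on_sh[OF L]]) (simp add: case_prod_unfold)
    also have "\<dots> \<le> sum F UNIV"
      by (rule sum_mono2) (use that in auto)
    finally show ?thesis .
  qed
  have square: "(\<Sum>v\<in>UNIV. norm (\<beta> v x))\<^sup>2 \<le> real (card (diamond R)) * (\<Sum>v\<in>UNIV. (norm (\<beta> v x))\<^sup>2)" for x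
  proof -
    obtain t where t: "\<And>v. \<beta> v x \<noteq> 0 \<Longrightarrow> t \<in> graph_ball grid v R"
      using support by blast
    let ?I = "{v. t \<in> graph_ball grid v R}"
    have "(\<Sum>v\<in>UNIV. norm (\<beta> v x)) = (\<Sum>v\<in>?I. norm (\<beta> v x))"
      using t by (intro sum.mono_neutral_right) auto
    then have "(\<Sum>v\<in>UNIV. norm (\<beta> v x))\<^sup>2 \<le> (\<Sum>v\<in>?I. (norm (\<beta> v x))\<^sup>2) * real (card ?I)"
      using sum_squared_le_sum_of_squares[of "\<lambda>v. norm (\<beta> v x)" ?I] by simp
    also have "\<dots> \<le> (\<Sum>v\<in>UNIV. (norm (\<beta> v x))\<^sup>2) * real (card (diamond R))"
      by (intro mult_mono sum_mono2) (auto simp: card_balls_containing intro: sum_nonneg)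
    finally show ?thesis
      by (simp add: mult.commute)
  qed
  have "(\<Sum>(a, b)\<in>?B. \<Sum>v\<in>UNIV. \<tau> a b v * Re (\<Sum>x\<in>UNIV. cnj (\<beta> v x) * \<beta> (sh a b v) x))
      \<le> (\<Sum>(a, b)\<in>?B. \<Sum>v\<in>UNIV. \<Sum>x\<in>UNIV. norm (\<beta> v x) * norm (\<beta> (sh a b v) x))"
    using pair by (intro sum_mono) (auto intro: sum_mono)
  also have "\<dots> = (\<Sum>x\<in>UNIV. \<Sum>v\<in>UNIV. \<Sum>(a, b)\<in>?B. norm (\<beta> v x) * norm (\<beta> (sh a b v) x))"
    unfolding case_prod_unfold
    by (subst sum.swap[of _ ?B], subst sum.swap[of _ UNIV UNIV], subst sum.swap[of _ ?B]) simp
  also have "\<dots> \<le> (\<Sum>x\<in>UNIV. \<Sum>v\<in>UNIV. norm (\<beta> v x) * (\<Sum>w\<in>UNIV. norm (\<beta> w x)))"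
    using box[of "\<lambda>w. norm (\<beta> w _)"]
    by (intro sum_mono) (simp add: case_prod_unfold sum_distrib_left[symmetric] mult_left_mono)
  also have "\<dots> = (\<Sum>x\<in>UNIV. (\<Sum>v\<in>UNIV. norm (\<beta> v x))\<^sup>2)"
    by (simp add: power2_eq_square sum_distrib_right)
  also have "\<dots> \<le> (\<Sum>x\<in>UNIV. real (card (diamond R)) * (\<Sum>v\<in>UNIV. (norm (\<beta> v x))\<^sup>2))"
    by (intro sum_mono square)
  also have "\<dots> = real (card (diamond R)) * (\<Sum>v\<in>UNIV. \<Sum>x\<in>UNIV. (norm (\<beta> v x))\<^sup>2)"
    by (subst sum.swap) (simp add: sum_distrib_left)
  finally show ?thesis
    by (simp add: unit)
qed

lemma energy_bound:
  fixes \<sigma> :: "'v set \<Rightarrow> real"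
  assumes R: "R \<ge> 1" and L: "2 * int R < L"
    and prep: "symmetrically_prepared grid R \<psi>"
    and \<sigma>: "\<forall>e\<in>grid. \<sigma> e \<in> {-1, 1}"
  shows "Re (expectation \<psi> (\<Sum>e\<in>grid. mat 1 + \<sigma> e *\<^sub>R ZZ e)) \<ge> 2 * real CARD('v) / (2 * real R + 1)"
proof -
  let ?B = "{- int R..int R} \<times> {- int R..int R}"
  obtain \<beta> :: "'v \<Rightarrow> ('v \<Rightarrow> bool) \<Rightarrow> complex" where
    corr: "\<And>u v. (\<Sum>x\<in>UNIV. cnj (\<beta> u x) * \<beta> v x)
        = of_real (\<Sum>x\<in>UNIV. (norm (\<psi> $ x))\<^sup>2 * (spin (x u) * spin (x v)))"
    and support: "\<And>x. \<exists>t. \<forall>v. \<beta> v x \<noteq> 0 \<longrightarrow> t \<in> graph_ball grid v R"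
    and total: "(\<Sum>x\<in>UNIV. (norm (\<psi> $ x))\<^sup>2) = 1"
    using pulled_back_correlations[OF prep] by blast
  define p where "p x = (norm (\<psi> $ x))\<^sup>2" for x
  \<comment> \<open>The minus sign turns \<open>1 + \<sigma> e\<close> times the spins into the form
    \<open>1 - \<eta> v\<close> times the spins used for frustration.\<close>
  define \<eta> where "\<eta> v = - \<sigma> {v, sh 1 0 v}" for v
  define \<kappa> where "\<kappa> v = - \<sigma> {v, sh 0 1 v}" for v
  define \<tau> where "\<tau> = path_sign \<eta> \<kappa>"
  have "{v, sh 1 0 v} \<in> grid" "{v, sh 0 1 v} \<in> grid" for v
    by (auto simp: grid_def)
  with \<sigma> have \<eta>: "\<eta> v \<in> {-1, 1}" and \<kappa>: "\<kappa> v \<in> {-1, 1}" for v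
    by (force simp: \<eta>_def \<kappa>_def)+
  define H where "H x = (\<Sum>v\<in>UNIV. 1 - \<eta> v * spin (x v) * spin (x (sh 1 0 v)))
      + (\<Sum>v\<in>UNIV. 1 - \<kappa> v * spin (x v) * spin (x (sh 0 1 v)))" for x
  have "(\<Sum>e\<in>grid. 1 + \<sigma> e * (\<Prod>w\<in>e. spin (x w))) = H x" for x
    using L R grid_edge_proper[symmetric] by (simp add: sum_grid H_def \<eta>_def \<kappa>_def mult.assoc)
  then have energy: "Re (expectation \<psi> (\<Sum>e\<in>grid. mat 1 + \<sigma> e *\<^sub>R ZZ e)) = (\<Sum>x\<in>UNIV. p x * H x)"
    by (simp add: expectation_energy p_def)
  let ?c = "(2 * real R + 1) * (real R * (real R + 1))"
  have unit: "(\<Sum>x\<in>UNIV. (norm (\<beta> v x))\<^sup>2) = 1" for v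
  proof -
    have "complex_of_real (\<Sum>x\<in>UNIV. (norm (\<beta> v x))\<^sup>2) = (\<Sum>x\<in>UNIV. cnj (\<beta> v x) * \<beta> v x)"
      by (simp only: of_real_sum complex_norm_square mult.commute)
    also have "\<dots> = 1"
      by (simp only: corr) (simp add: spin_def if_distrib[of "\<lambda>c. c * _"] total cong: if_cong)
    finally show ?thesis
      by (simp only: of_real_eq_1_iff)
  qed
  have \<tau>: "\<bar>\<tau> a b v\<bar> \<le> 1" for a b v
    using path_sign_values[of \<eta> \<kappa> a b v, OF \<eta> \<kappa>] by (auto simp: \<tau>_def)
  have "(\<Sum>(a, b)\<in>?B. \<Sum>v\<in>UNIV. \<tau> a b v * (\<Sum>x\<in>UNIV. p x * (spin (x v) * spin (x (sh a b v)))))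
      \<le> real (card (diamond R)) * real CARD('v)" (is "?T \<le> _")
    using correlation_bound[OF L support unit \<tau>] by (simp add: corr p_def)
  moreover have "(2 * real R + 1)\<^sup>2 * real CARD('v) - ?T \<le> ?c * (\<Sum>x\<in>UNIV. p x * H x)"
  proof -
    have "(2 * real R + 1)\<^sup>2 * real CARD('v) - ?T
        = (\<Sum>(a, b)\<in>?B. \<Sum>v\<in>UNIV. 1 - \<tau> a b v * (\<Sum>x\<in>UNIV. p x * (spin (x v) * spin (x (sh a b v)))))"
      by (simp add: case_prod_unfold sum_subtractf power2_eq_square)
    also have "\<dots> = (\<Sum>(a, b)\<in>?B. \<Sum>v\<in>UNIV. \<Sum>x\<in>UNIV. p x * (1 - \<tau> a b v * (spin (x v) * spin (x (sh a b v)))))"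
      using total by (simp add: right_diff_distrib sum_subtractf sum_distrib_left mult_ac p_def)
    also have "\<dots> = (\<Sum>x\<in>UNIV. p x * (\<Sum>(a, b)\<in>?B. \<Sum>v\<in>UNIV. 1 - \<tau> a b v * (spin (x v) * spin (x (sh a b v)))))"
      unfolding case_prod_unfold sum_distrib_left
      by (subst sum.swap[of _ UNIV UNIV], subst sum.swap[of _ ?B]) simp
    also have "\<dots> \<le> (\<Sum>x\<in>UNIV. p x * (?c * H x))"
      unfolding \<tau>_def H_def
      by (intro sum_mono mult_left_mono total_frustration \<eta> \<kappa> spin_values) (simp add: p_def)
    finally show ?thesis
      by (simp add: sum_distrib_left mult_ac)
  qed
  moreover have "real (card (diamond R)) = 2 * real R * (real R + 1) + 1"
    using arg_cong[OF card_diamond[of R], of real_of_int] by simp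
  \<comment> \<open>The constant is the box size minus the diamond size: \<open>(2 * R + 1)\<^sup>2
    - (2 * R * (R + 1) + 1) = 2 * R * (R + 1)\<close>.\<close>
  ultimately have "2 * (real R * (real R + 1)) * real CARD('v) \<le> ?c * (\<Sum>x\<in>UNIV. p x * H x)"
    by (simp add: power2_eq_square algebra_simps)
  then have "(real R * (real R + 1)) * (2 * real CARD('v))
      \<le> (real R * (real R + 1)) * ((2 * real R + 1) * (\<Sum>x\<in>UNIV. p x * H x))"
    by (simp only: mult_ac)
  then have "2 * real CARD('v) \<le> (2 * real R + 1) * (\<Sum>x\<in>UNIV. p x * H x)"
    \<comment> \<open>Here \<open>R \<ge> 1\<close> makes the common factor
      \<open>R * (R + 1)\<close> positive.\<close>
    by (rule mult_left_le_imp_le) (use R in simp)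
  then show ?thesis
    unfolding energy by (simp add: field_simps)
qed

text \<open>Each cut term is 1 minus half of the corresponding energy term with all signs equal to
  1, and the grid has two edges per vertex.\<close>

lemma maxcut_bound:
  assumes R: "R \<ge> 1" and L: "2 * int R < L"
    and prep: "symmetrically_prepared grid R \<psi>"
  shows "Re (expectation \<psi> (maxcut_hamiltonian grid))
    \<le> 2 * real CARD('v) - real CARD('v) / (2 * real R + 1)"
proof -
  have total: "(\<Sum>x\<in>UNIV. (norm (\<psi> $ x))\<^sup>2) = 1"
    using pulled_back_correlations[OF prep] by blast
  have card: "real (card grid) = 2 * real CARD('v)"
    using sum_grid[of "\<lambda>_. 1"] L R by simp
  have "(\<Sum>e\<in>grid. 1 / 2 * (1 - (\<Prod>w\<in>e. spin (x w))))
      = 2 * real CARD('v) - 1 / 2 * (\<Sum>e\<in>grid. 1 + 1 * (\<Prod>w\<in>e. spin (x w)))" for x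
    by (simp add: sum_subtractf sum.distrib sum_distrib_left[symmetric] sum_divide_distrib[symmetric] card
        diff_divide_distrib add_divide_distrib)
  then have "Re (expectation \<psi> (maxcut_hamiltonian grid))
      = 2 * real CARD('v) - 1 / 2 * Re (expectation \<psi> (\<Sum>e\<in>grid. mat 1 + 1 *\<^sub>R ZZ e))"
    unfolding expectation_maxcut expectation_energy
    by (simp only: right_diff_distrib sum_subtractf sum_distrib_right[symmetric] total)
      (simp add: sum_distrib_left mult_ac)
  moreover have "Re (expectation \<psi> (\<Sum>e\<in>grid. mat 1 + 1 *\<^sub>R ZZ e))
      \<ge> 2 * (real CARD('v) / (2 * real R + 1))"
    using energy_bound[OF R L prep, of "\<lambda>_. 1"] by simp
  ultimately show ?thesis
    by linarith
qed

end

text \<open>Adding integers modulo \<open>L\<close> to the coordinates and transporting along the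
  labelling \<open>f\<close> gives the translations; the defining edges are the unit steps in the
  two directions.\<close>

lemma torus_grid_action:
  fixes E :: "'v::finite set set"
  assumes "torus_grid L L E"
  shows "CARD('v) = L * L" and "\<exists>sh. torus_action sh (int L) \<and> E = torus_action.grid sh"
proof -
  obtain f :: "'v \<Rightarrow> nat \<times> nat" where f: "bij_betw f UNIV ({..<L} \<times> {..<L})"
    and E: "E = {{u, v} | u v. f v = ((fst (f u) + 1) mod L, snd (f u)) \<or>
                               f v = (fst (f u), (snd (f u) + 1) mod L)}"
    using assms by (auto simp: torus_grid_def)
  show "CARD('v) = L * L"
    using bij_betw_same_card[OF f] by simp
  define g where "g = inv_into UNIV f"
  have gf: "g (f v) = v" for v
    using f by (simp add: g_def bij_betw_def)
  have fg: "f (g q) = q" if "q \<in> {..<L} \<times> {..<L}" for q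
    using f that by (simp add: g_def bij_betw_inv_into_right)
  have bound: "fst (f v) < L" "snd (f v) < L" for v
    using bij_betwE[OF f, THEN bspec, of v] by (auto simp: mem_Times_iff)
  have L: "L > 0"
    using bound(1)[of undefined] by simp
  define sh where "sh a b v =
    g (nat ((int (fst (f v)) + a) mod int L), nat ((int (snd (f v)) + b) mod int L))" for a b v
  have f_sh: "f (sh a b v) = (nat ((int (fst (f v)) + a) mod int L), nat ((int (snd (f v)) + b) mod int L))"
    for a b v
    unfolding sh_def using L by (intro fg) (auto simp: nat_less_iff)
  have eq_sh: "u = sh a b v \<longleftrightarrow> f u = (nat ((int (fst (f v)) + a) mod int L), nat ((int (snd (f v)) + b) mod int L))"
    for u v a b
    by (metis f_sh gf)
  have act: "torus_action sh (int L)"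
  proof
    show "sh 0 0 v = v" for v
      using bound[of v] by (simp add: eq_sh[of v 0 0 v, THEN iffD2, symmetric] prod_eq_iff)
    show "sh a b (sh c d v) = sh (a + c) (b + d) v" for a b c d v
      using L by (subst eq_sh) (simp add: f_sh mod_simps algebra_simps)
    show "int L dvd a \<and> int L dvd b" if "sh a b v = v" for a b v
    proof -
      have "f v = (nat ((int (fst (f v)) + a) mod int L), nat ((int (snd (f v)) + b) mod int L))"
        using that eq_sh[of v a b v] by simp
      from arg_cong[OF this, of "\<lambda>q. int (fst q)"] arg_cong[OF this, of "\<lambda>q. int (snd q)"]
      have "int (fst (f v)) = int (nat ((int (fst (f v)) + a) mod int L))"
        "int (snd (f v)) = int (nat ((int (snd (f v)) + b) mod int L))"
        unfolding fst_conv snd_conv .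
      then have "int (fst (f v)) = (int (fst (f v)) + a) mod int L"
        "int (snd (f v)) = (int (snd (f v)) + b) mod int L"
        using L by simp_all
      \<comment> \<open>Coordinates are already reduced modulo \<open>L\<close>, so both sides can
        be written as residues and their equality becomes divisibility of \<open>a\<close> and
        \<open>b\<close>.\<close>
      then have "(int (fst (f v)) + a) mod int L = int (fst (f v)) mod int L"
        "(int (snd (f v)) + b) mod int L = int (snd (f v)) mod int L"
        by (metis mod_mod_trivial)+
      then show ?thesis
        by (simp add: mod_eq_dvd_iff)
    qed
  qed
  have right: "f v = ((fst (f u) + 1) mod L, snd (f u)) \<longleftrightarrow> v = sh 1 0 u" for u v
    using bound[of u] by (simp add: eq_sh nat_mod_distrib nat_add_distrib)
  have up: "f v = (fst (f u), (snd (f u) + 1) mod L) \<longleftrightarrow> v = sh 0 1 u" for u v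
    using bound[of u] by (simp add: eq_sh nat_mod_distrib nat_add_distrib)
  have "E = torus_action.grid sh"
    unfolding E right up torus_action.grid_def[OF act] by auto
  with act show "\<exists>sh. torus_action sh (int L) \<and> E = torus_action.grid sh"
    by blast
qed

theorem proposition37:
  fixes R k n :: nat
    and E :: "'v::finite set set"
    and \<psi> :: "'v state"
  assumes "R \<ge> 1" and "k \<ge> 1"
    and "torus_grid ((2 * R + 1) * k) ((2 * R + 1) * k) E"
    and "n = (2 * R + 1)\<^sup>2 * k\<^sup>2"
    and "symmetrically_prepared E R \<psi>"
  shows "(\<forall>\<sigma> :: 'v set \<Rightarrow> real. (\<forall>e\<in>E. \<sigma> e \<in> {-1, 1}) \<longrightarrow>
            Re (expectation \<psi> (\<Sum>e\<in>E. mat 1 + \<sigma> e *\<^sub>R ZZ e)) \<ge> 2 * real n / (2 * real R + 1)) \<and>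
         Re (expectation \<psi> (maxcut_hamiltonian E)) \<le> 2 * real n - real n / (2 * real R + 1)"
proof -
  define L where "L = (2 * R + 1) * k"
  have torus: "torus_grid L L E"
    using assms(3) by (simp only: L_def)
  obtain sh where act: "torus_action sh (int L)" and E: "E = torus_action.grid sh"
    using torus_grid_action(2)[OF torus] by blast
  interpret torus_action sh "int L"
    by (rule act)
  have n: "n = CARD('v)"
    using torus_grid_action(1)[OF torus] by (simp add: assms(4) L_def power2_eq_square algebra_simps)
  have "(2 * R + 1) * 1 \<le> L"
    unfolding L_def using assms(2) by (intro mult_le_mono2)
  then have L: "2 * int R < int L"
    by simp
  show ?thesis
    using energy_bound[OF assms(1) L] maxcut_bound[OF assms(1) L] assms(5)
    unfolding E n by blast
qed

end
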